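(* Let $P=([n],\preceq)$ be a chain, $w$ a weight on $\mathbb{F}_q$, $\pi(i)=k_i$ a label map with $N=k_1+\cdots+k_n$, and $\mathbb{C}\subseteq\mathbb{F}_q^N$ a code with $|\mathbb{C}|\ge2$ and minimum distance $d_{(P,w,\pi)}(\mathbb{C})$. Then $\sum_{i\in J}k_i\le N-\lceil\log_q|\mathbb{C}|\rceil$ for any ideal $J$ of $P$ with $|J|=\big\lfloor\frac{d_{(P,w,\pi)}(\mathbb{C})-1}{M_w}\big\rfloor$.
   Context: A weight on $\mathbb{F}_q$ is a map $w:\mathbb{F}_q\to\mathbb{N}\cup\{0\}$ with $w(\alpha)=0$ iff $\alpha=0$, $w(-\alpha)=w(\alpha)$, $w(\alpha+\beta)\le w(\alpha)+w(\beta)$; $M_w=\max_\alpha w(\alpha)$; $\tilde w^k(v)=\max_s w(v_s)$. Ideals of $P$ are down-closed subsets; $\langle A\rangle$ is the generated ideal. For $x=x_1\oplus\cdots\oplus x_n\in\mathbb{F}_q^{k_1}\oplus\cdots\oplus\mathbb{F}_q^{k_n}$, $supp_\pi(x)=\{i:x_i\ne0\}$, $I_x=\langle supp_\pi(x)\rangle$, $M_x$ its maximal elements, $w_{(P,w,\pi)}(x)=\sum_{i\in M_x}\tilde w^{k_i}(x_i)+|I_x\setminus M_x|\,M_w$, $d_{(P,w,\pi)}(x,y)=w_{(P,w,\pi)}(x-y)$, and $d_{(P,w,\pi)}(\mathbb{C})$ is the minimum distance between distinct codewords. *)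

theory Defs
  imports Complex_Main "HOL-Library.Cardinality" "Jordan_Normal_Form.Matrix"
begin

definition is_weight :: "('a::{field,finite} \<Rightarrow> nat) \<Rightarrow> bool" where
  "is_weight w \<longleftrightarrow>
     (\<forall>a. w a = 0 \<longleftrightarrow> a = 0) \<and> (\<forall>a. w (- a) = w a) \<and> (\<forall>a b. w (a + b) \<le> w a + w b)"

definition max_weight :: "('a::{field,finite} \<Rightarrow> nat) \<Rightarrow> nat" where
  "max_weight w = Max (range w)"

text \<open>
  The value at the empty vector is unspecified. The poset block weight below only evaluates
  this function at nonzero blocks, which are never empty.
\<close>

definition block_max_weight :: "('a::{field,finite} \<Rightarrow> nat) \<Rightarrow> 'a vec \<Rightarrow> nat" where
  "block_max_weight w v = Max ((\<lambda>s. w (v $ s)) ` {0..<dim_vec v})"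

text \<open>
  Posets live on \<open>{1..n}\<close> and are given as relations, with \<open>(a, b) \<in> P\<close> meaning that \<open>a\<close> is
  below or equal to \<open>b\<close>.
\<close>

definition is_ideal :: "nat \<Rightarrow> nat rel \<Rightarrow> nat set \<Rightarrow> bool" where
  "is_ideal n P I \<longleftrightarrow> I \<subseteq> {1..n} \<and> (\<forall>b\<in>I. \<forall>a\<in>{1..n}. (a, b) \<in> P \<longrightarrow> a \<in> I)"

definition generated_ideal :: "nat \<Rightarrow> nat rel \<Rightarrow> nat set \<Rightarrow> nat set" where
  "generated_ideal n P A = is_ideal n P hull A"

definition maximal_elements :: "nat rel \<Rightarrow> nat set \<Rightarrow> nat set" where
  "maximal_elements P I = {i \<in> I. \<forall>j\<in>I. (i, j) \<in> P \<longrightarrow> j = i}"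

definition total_length :: "nat \<Rightarrow> (nat \<Rightarrow> nat) \<Rightarrow> nat" where
  "total_length n k = (\<Sum>i\<in>{1..n}. k i)"

text \<open>
  The \<open>i\<close>-th component of a vector under the decomposition of the full space into a direct sum
  of spaces of dimensions \<open>k 1, \<dots>, k n\<close>: the consecutive entries starting at position
  \<open>k 1 + \<dots> + k (i - 1)\<close>. Vector entries are indexed from 0, blocks from 1.
\<close>

definition block :: "(nat \<Rightarrow> nat) \<Rightarrow> 'a vec \<Rightarrow> nat \<Rightarrow> 'a vec" where
  "block k x i = vec (k i) (\<lambda>s. x $ ((\<Sum>j\<in>{1..<i}. k j) + s))"

definition block_support :: "nat \<Rightarrow> (nat \<Rightarrow> nat) \<Rightarrow> 'a::zero vec \<Rightarrow> nat set" where
  "block_support n k x = {i \<in> {1..n}. block k x i \<noteq> 0\<^sub>v (k i)}"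

definition support_ideal :: "nat \<Rightarrow> nat rel \<Rightarrow> (nat \<Rightarrow> nat) \<Rightarrow> 'a::zero vec \<Rightarrow> nat set" where
  "support_ideal n P k x = generated_ideal n P (block_support n k x)"

definition pw_block_weight ::
  "nat \<Rightarrow> nat rel \<Rightarrow> ('a::{field,finite} \<Rightarrow> nat) \<Rightarrow> (nat \<Rightarrow> nat) \<Rightarrow> 'a vec \<Rightarrow> nat" where
  "pw_block_weight n P w k x =
     (let I = support_ideal n P k x; M = maximal_elements P I
      in (\<Sum>i\<in>M. block_max_weight w (block k x i)) + card (I - M) * max_weight w)"

definition pw_block_dist ::
  "nat \<Rightarrow> nat rel \<Rightarrow> ('a::{field,finite} \<Rightarrow> nat) \<Rightarrow> (nat \<Rightarrow> nat) \<Rightarrow> 'a vec \<Rightarrow> 'a vec \<Rightarrow> nat" where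
  "pw_block_dist n P w k x y = pw_block_weight n P w k (x - y)"

definition min_dist ::
  "nat \<Rightarrow> nat rel \<Rightarrow> ('a::{field,finite} \<Rightarrow> nat) \<Rightarrow> (nat \<Rightarrow> nat) \<Rightarrow> 'a vec set \<Rightarrow> nat" where
  "min_dist n P w k C = Min {pw_block_dist n P w k x y | x y. x \<in> C \<and> y \<in> C \<and> x \<noteq> y}"

end

theory Submission
  imports Defs
begin

text \<open>
  Two codewords that agree on every block outside \<open>J\<close> have a difference supported in the ideal
  \<open>J\<close>, so their distance is at most \<open>|J| M\<^sub>w < d(C)\<close> and they are equal. Hence deleting the
  blocks of \<open>J\<close> is injective on the code, which gives \<open>|C| \<le> q ^ (N - (\<Sum>i\<in>J. k i))\<close>.
\<close>

text \<open>The indices, counted from 0, that \<open>block k x i\<close> reads.\<close>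

definition block_positions :: "(nat \<Rightarrow> nat) \<Rightarrow> nat \<Rightarrow> nat set" where
  "block_positions k i = {(\<Sum>j\<in>{1..<i}. k j)..<(\<Sum>j\<in>{1..<i}. k j) + k i}"

text \<open>Entries of a difference of vectors can be computed only at indices within its dimension;
  this bound places every position of a block there.\<close>

lemma block_positions_less_total_length:
  assumes "i \<in> {1..n}" and "s < k i"
  shows "(\<Sum>j\<in>{1..<i}. k j) + s < total_length n k"
proof -
  have "(\<Sum>j\<in>{1..<i}. k j) + k i = (\<Sum>j\<in>insert i {1..<i}. k j)"
    by simp
  also have "\<dots> \<le> total_length n k"
    unfolding total_length_def using assms(1) by (intro sum_mono2) auto
  finally show ?thesis
    using assms(2) by simp
qed

text \<open>The carrier hypothesis concerns \<open>y\<close> because \<open>x - y\<close> takes its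
  dimension from the second argument.\<close>

lemma block_diff_eq_0:
  fixes x y :: "'a::ab_group_add vec"
  assumes "i \<in> {1..n}" and "y \<in> carrier_vec (total_length n k)"
    and "\<And>t. t \<in> block_positions k i \<Longrightarrow> x $ t = y $ t"
  shows "block k (x - y) i = 0\<^sub>v (k i)"
proof (rule eq_vecI)
  fix s assume "s < dim_vec (0\<^sub>v (k i) :: 'a vec)"
  then have s: "s < k i" by simp
  then have "(\<Sum>j\<in>{1..<i}. k j) + s < dim_vec y"
    using block_positions_less_total_length[of i n s k] assms(1,2) by simp
  moreover have "(\<Sum>j\<in>{1..<i}. k j) + s \<in> block_positions k i"
    using s by (simp add: block_positions_def)
  ultimately show "block k (x - y) i $ s = 0\<^sub>v (k i) $ s"
    using s assms(3) by (simp add: block_def)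
qed (simp add: block_def)

lemma weight_le_max_weight: "w a \<le> max_weight w"
  unfolding max_weight_def by (intro Max_ge) auto

text \<open>The element 1 is nonzero and so has nonzero weight. Positivity lets the division by
  \<open>max_weight w\<close> be cleared later.\<close>

lemma max_weight_pos: "is_weight w \<Longrightarrow> 0 < max_weight w"
  using weight_le_max_weight[of w 1] by (metis is_weight_def gr0I le_0_eq one_neq_zero)

text \<open>Nonemptiness matters: the \<open>Max\<close> over the entries of an empty block is
  unspecified.\<close>

lemma block_max_weight_le:
  assumes "0 < dim_vec v"
  shows "block_max_weight w v \<le> max_weight w"
  unfolding block_max_weight_def using assms by (subst Max_le_iff) (auto simp: weight_le_max_weight)

text \<open>Each maximal element of the support ideal contributes at most
  \<open>max_weight w\<close> and every other element exactly that much, so the weight is at most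
  \<open>max_weight w\<close> times the size of the support ideal, which lies inside
  \<open>J\<close>.\<close>

lemma pw_block_weight_le:
  assumes "is_ideal n P J" and "block_support n k x \<subseteq> J" and "\<And>i. i \<in> {1..n} \<Longrightarrow> 1 \<le> k i"
  shows "pw_block_weight n P w k x \<le> card J * max_weight w"
proof -
  define I where "I = support_ideal n P k x"
  define M where "M = maximal_elements P I"
  have J: "J \<subseteq> {1..n}"
    using assms(1) by (simp add: is_ideal_def)
  \<comment> \<open>The hull is the intersection of all ideals containing the support, and
    \<open>J\<close> is one of them.\<close>
  have IJ: "I \<subseteq> J"
    unfolding I_def support_ideal_def generated_ideal_def using assms(1,2) by (rule hull_minimal[rotated])
  have "finite J"
    using J by (rule finite_subset) simp
  then have "finite I"
    using IJ by (rule finite_subset[rotated])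
  have MI: "M \<subseteq> I"
    by (auto simp: M_def maximal_elements_def)
  have "(\<Sum>i\<in>M. block_max_weight w (block k x i)) \<le> (\<Sum>i\<in>M. max_weight w)"
  proof (intro sum_mono block_max_weight_le)
    fix i assume "i \<in> M"
    then have "1 \<le> k i"
      using assms(3) MI IJ J by blast
    then show "0 < dim_vec (block k x i)"
      by (simp add: block_def)
  qed
  then have "pw_block_weight n P w k x \<le> (card M + card (I - M)) * max_weight w"
    by (simp add: pw_block_weight_def I_def M_def Let_def distrib_right)
  also have "card M + card (I - M) = card I"
    using MI \<open>finite I\<close> by (simp add: card_Diff_subset card_mono finite_subset)
  also have "card I * max_weight w \<le> card J * max_weight w"
    using IJ \<open>finite J\<close> by (simp add: card_mono)
  finally show ?thesis .
qed

lemma min_dist_le: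
  assumes "finite C" and "x \<in> C" and "y \<in> C" and "x \<noteq> y"
  shows "min_dist n P w k C \<le> pw_block_dist n P w k x y"
  unfolding min_dist_def
proof (rule Min_le)
  show "finite {pw_block_dist n P w k x y | x y. x \<in> C \<and> y \<in> C \<and> x \<noteq> y}"
    by (rule finite_subset[of _ "(\<lambda>(x, y). pw_block_dist n P w k x y) ` (C \<times> C)"])
      (use assms(1) in auto)
qed (use assms in blast)

lemma card_code_le:
  fixes C :: "'a::{field,finite} vec set"
  assumes "\<And>i. i \<in> {1..n} \<Longrightarrow> 1 \<le> k i"
    and "finite C" and "C \<subseteq> carrier_vec (total_length n k)"
    and "is_ideal n P J" and "card J * max_weight w < min_dist n P w k C"
  shows "card C \<le> CARD('a) ^ (\<Sum>i\<in>{1..n} - J. k i)"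
proof -
  define S where "S = (\<Union>i\<in>{1..n} - J. block_positions k i)"
  have "finite S"
    by (auto simp: S_def block_positions_def)
  \<comment> \<open>Deleting the blocks of \<open>J\<close> is modelled by restricting the indexing
    function to the remaining positions, so that the images lie in the finite space
    \<open>S \<rightarrow>\<^sub>E UNIV\<close>.\<close>
  have "inj_on (\<lambda>x. restrict (($) x) S) C"
  proof (rule inj_onI, rule ccontr)
    fix x y
    assume xy: "x \<in> C" "y \<in> C" "restrict (($) x) S = restrict (($) y) S" "x \<noteq> y"
    have agree: "x $ t = y $ t" if "t \<in> S" for t
      using xy(3) that by (metis restrict_apply')
    have "block k (x - y) i = 0\<^sub>v (k i)" if "i \<in> {1..n} - J" for i
    proof (rule block_diff_eq_0[of i n])
      show "x $ t = y $ t" if "t \<in> block_positions k i" for t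
        using that \<open>i \<in> {1..n} - J\<close> by (intro agree) (auto simp: S_def)
    qed (use that xy(2) assms(3) in auto)
    then have "block_support n k (x - y) \<subseteq> J"
      by (auto simp: block_support_def)
    then have "pw_block_dist n P w k x y \<le> card J * max_weight w"
      unfolding pw_block_dist_def by (intro pw_block_weight_le assms(1,4))
    with min_dist_le[OF assms(2) xy(1,2,4), of n P w k] assms(5) show False
      by linarith
  qed
  moreover have "(\<lambda>x. restrict (($) x) S) ` C \<subseteq> S \<rightarrow>\<^sub>E UNIV"
    by auto
  ultimately have "card C \<le> card (S \<rightarrow>\<^sub>E (UNIV :: 'a set))"
    using \<open>finite S\<close> by (intro card_inj_on_le) (auto intro: finite_PiE)
  also have "\<dots> = CARD('a) ^ card S"
    using \<open>finite S\<close> by (simp add: card_PiE)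
  \<comment> \<open>An upper estimate of the exponent is what the goal asks for, and the union bound
    provides it.\<close>
  also have "card S \<le> (\<Sum>i\<in>{1..n} - J. card (block_positions k i))"
    unfolding S_def by (rule card_UN_le) simp
  then have "CARD('a) ^ card S \<le> CARD('a) ^ (\<Sum>i\<in>{1..n} - J. k i)"
    by (intro power_increasing) (simp_all add: block_positions_def Suc_le_eq)
  finally show ?thesis .
qed

theorem theorem5p1:
  fixes n :: nat and P :: "nat rel" and w :: "'a::{field,finite} \<Rightarrow> nat"
    and k :: "nat \<Rightarrow> nat" and C :: "'a vec set" and J :: "nat set"
  assumes "linear_order_on {1..n} P"
    and "is_weight w"
    and "\<And>i. i \<in> {1..n} \<Longrightarrow> 1 \<le> k i"
    and "C \<subseteq> carrier_vec (total_length n k)"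
    and "2 \<le> card C"
    and "is_ideal n P J"
    and "int (card J) = \<lfloor>(real (min_dist n P w k C) - 1) / real (max_weight w)\<rfloor>"
  shows "int (\<Sum>i\<in>J. k i) \<le> int (total_length n k) - \<lceil>log (real CARD('a)) (real (card C))\<rceil>"
proof -
  have "finite C"
    using assms(5) by (metis card.infinite not_numeral_le_zero)
  have J: "J \<subseteq> {1..n}"
    using assms(6) by (simp add: is_ideal_def)
  have "real (card J) \<le> (real (min_dist n P w k C) - 1) / real (max_weight w)"
    using assms(7) by (metis of_int_floor_le of_int_of_nat_eq)
  then have "real (card J * max_weight w) \<le> real (min_dist n P w k C) - 1"
    using max_weight_pos[OF assms(2)] by (simp add: pos_le_divide_eq)
  \<comment> \<open>The 1 was subtracted in the reals, without truncation at 0, so the inequality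
    becomes strict.\<close>
  then have "card J * max_weight w < min_dist n P w k C"
    by linarith
  then have "card C \<le> CARD('a) ^ (\<Sum>i\<in>{1..n} - J. k i)"
    using assms(3,4,6) \<open>finite C\<close> by (intro card_code_le)
  \<comment> \<open>The distinct field elements 0 and 1 make the base of the logarithm exceed 1, as
    monotonicity requires.\<close>
  moreover have "1 < CARD('a)"
    using card_mono[of UNIV "{0, 1::'a}"] by simp
  ultimately have "log (real CARD('a)) (real (card C)) \<le> real (\<Sum>i\<in>{1..n} - J. k i)"
    using assms(5) by (intro log_of_power_le) (simp_all flip: of_nat_power)
  \<comment> \<open>The bound is an integer, so it survives rounding up.\<close>
  then have "\<lceil>log (real CARD('a)) (real (card C))\<rceil> \<le> int (\<Sum>i\<in>{1..n} - J. k i)"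
    by (simp add: ceiling_le_iff)
  moreover have "total_length n k = (\<Sum>i\<in>{1..n} - J. k i) + (\<Sum>i\<in>J. k i)"
    unfolding total_length_def using J by (intro sum.subset_diff) auto
  ultimately show ?thesis
    by simp
qed

end
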